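(* For any positive integer $m$, there exists a correspondence between $\mathbb{S}^m$ and $\mathbb{S}^{m+1}$ with distortion at most $\eta_m$, where $$\eta_m:=\begin{cases}\arccos\left(-\frac{m+1}{m+3}\right)&\text{for }m\text{ odd},\\ \arccos\left(-\sqrt{\frac{m}{m+4}}\right)&\text{for }m\text{ even}.\end{cases}$$
   Context: For an integer $m\ge 0$, $\mathbb{S}^m=\{x\in\mathbb{R}^{m+1}:\|x\|=1\}$ is the unit sphere with the geodesic distance $d_{\mathbb{S}^m}(x,x')=\arccos\langle x,x'\rangle$. A correspondence between metric spaces $X$ and $Y$ is a relation $R\subseteq X\times Y$ whose projections to $X$ and to $Y$ are both surjective; its distortion is $\operatorname{dis}(R)=\sup_{(x,y),(x',y')\in R}|d_X(x,x')-d_Y(y,y')|$. (The number $\eta_m$ is the geodesic diameter of a face of a regular geodesic simplex in $\mathbb{S}^m$, i.e. of the geodesic convex hull in $\mathbb{S}^m$ of $m+1$ of the $m+2$ vertices of a regular $(m+1)$-simplex inscribed in $\mathbb{S}^m$.) *)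

theory Defs
  imports "HOL-Analysis.Analysis"
begin

text \<open>The library models the points of the Euclidean space of dimension \<open>n\<close> as the functions
  \<open>nat \<Rightarrow> real\<close> that vanish at all indices \<open>i \<ge> n\<close>; this allows the dimension to be an ordinary
  quantified natural number. The unit sphere of dimension \<open>m\<close> is the carrier of the library's
  \<^const>\<open>nsphere\<close>.\<close>

definition unit_sphere :: "nat \<Rightarrow> (nat \<Rightarrow> real) set"
  where "unit_sphere m = topspace (nsphere m)"

lemma unit_sphere_iff:
  "x \<in> unit_sphere m \<longleftrightarrow> (\<Sum>i\<le>m. (x i)\<^sup>2) = 1 \<and> (\<forall>i>m. x i = 0)"
  by (simp add: unit_sphere_def nsphere)

text \<open>Meaningful for \<open>x\<close> and \<open>y\<close> in \<^term>\<open>unit_sphere m\<close> only: there the sum is the full inner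
  product, because the remaining coordinates vanish.\<close>

definition sphere_dist :: "nat \<Rightarrow> (nat \<Rightarrow> real) \<Rightarrow> (nat \<Rightarrow> real) \<Rightarrow> real"
  where "sphere_dist m x y = arccos (\<Sum>i\<le>m. x i * y i)"

definition correspondence :: "'a set \<Rightarrow> 'b set \<Rightarrow> ('a \<times> 'b) set \<Rightarrow> bool"
  where "correspondence X Y R \<longleftrightarrow> R \<subseteq> X \<times> Y \<and> fst ` R = X \<and> snd ` R = Y"

text \<open>The supremum is taken in \<^typ>\<open>ennreal\<close>, so that the distortion is \<open>\<infinity>\<close> (and not an
  unspecified real) when the differences of distances are unbounded.\<close>

definition distortion ::
    "('a \<Rightarrow> 'a \<Rightarrow> real) \<Rightarrow> ('b \<Rightarrow> 'b \<Rightarrow> real) \<Rightarrow> ('a \<times> 'b) set \<Rightarrow> ennreal"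
  where "distortion dX dY R =
    (SUP ((x, y), (x', y')) \<in> R \<times> R. ennreal \<bar>dX x x' - dY y y'\<bar>)"

definition eta :: "nat \<Rightarrow> real"
  where "eta m =
    (if odd m then arccos (- ((real m + 1) / (real m + 3)))
     else arccos (- sqrt (real m / (real m + 4))))"

text \<open>Hence \<^term>\<open>ennreal (eta m)\<close> is not truncated.\<close>

lemma eta_nonneg: "0 \<le> eta m"
proof -
  have "0 \<le> arccos (- t)" if "0 \<le> t" "t \<le> 1" for t :: real
    using that by (intro arccos_lbound) auto
  then show ?thesis
    unfolding eta_def by simp
qed

end

theory Submission
  imports Defs
begin

text \<open>Inscribe a regular simplex with vertices \<open>u\<^sub>0, \<dots>, u\<^sub>m\<^sub>+\<^sub>1\<close> in the sphere of dimension \<open>m\<close>,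
  regarded as the equator of the sphere of dimension \<open>m + 1\<close>, and divide the closed upper
  hemisphere into the cones, with apex the north pole, over the Voronoi cells of the vertices.
  The correspondence relates every equatorial point to itself, every point of the cone over the
  cell of \<open>u\<^sub>i\<close> to \<open>u\<^sub>i\<close>, and is made invariant under the simultaneous antipodal map. Both
  projections are onto because the equator and the cones cover everything up to sign.

  Replacing one of two points by its antipode changes both distances from \<open>d\<close> to \<open>pi - d\<close>, so the
  distortion has to be bounded only for pairs that lie in the upper hemisphere. Suppose that
  every cone has diameter at most \<open>\<eta>\<close>. Two points of one cone have related distance \<open>0\<close>; an
  equatorial point and a point of a cone are handled by the triangle inequality, since \<open>u\<^sub>i\<close> lies in
  its own cone; two points of different cones have related distance \<open>\<zeta> = arccos (- 1 / (m + 1))\<close>,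
  where \<open>pi - \<zeta> \<le> \<zeta> \<le> \<eta>\<close>. Together these are \<open>upper_relation_distortion\<close>.

  That \<open>\<eta> = eta m\<close> bounds the diameter of a cone is the main point. It reduces to
  \<open>ip_cell_lower_bound\<close>: \<open>\<langle>x, y\<rangle> \<ge> cos \<eta>\<close> for \<open>x\<close>, \<open>y\<close> of norm at most \<open>1\<close> in the linear cone
  spanned by one Voronoi cell. In the coordinates
  \<open>a\<^sub>k = \<langle>x, u\<^sub>i\<rangle> - \<langle>x, u\<^sub>k\<rangle> \<ge> 0\<close>, \<open>k \<noteq> i\<close>, and likewise \<open>b\<^sub>k\<close> for \<open>y\<close>, the inner product is a multiple
  of the covariance form \<open>\<Sum> a\<^sub>k b\<^sub>k - (\<Sum> a\<^sub>k) (\<Sum> b\<^sub>k) / (m + 2)\<close>. With \<open>c = - cos \<eta>\<close> it suffices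
  that \<open>c / 2 * (\<parallel>a\<parallel>\<^sup>2 + \<parallel>b\<parallel>\<^sup>2) + \<langle>a, b\<rangle> \<ge> 0\<close> for this form on the positive orthant. For fixed \<open>a + b\<close>
  the left side is concave in each pair \<open>(a\<^sub>k, b\<^sub>k)\<close>, so \<open>a\<close> and \<open>b\<close> may be assumed to have disjoint
  supports, that is, \<open>x\<close> and \<open>y\<close> to lie on complementary faces of the cell, which is the geodesic
  simplex with vertices \<open>- u\<^sub>k\<close>, \<open>k \<noteq> i\<close>. There the inequality follows from Cauchy--Schwarz and the
  inequality between arithmetic and geometric mean, with the constant \<open>sqrt (p q / ((p + 1) (q + 1)))\<close> for \<open>p + q = m + 1\<close>; this is
  largest when \<open>p\<close> and \<open>q\<close> are as equal as the parity of \<open>m\<close> permits, whence the two cases of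
  \<open>eta\<close>.\<close>

section \<open>Geodesic distance on spheres\<close>

text \<open>The summation stops at \<open>m\<close> even if \<open>x\<close> and \<open>y\<close> have further coordinates: for points of the
  sphere of dimension \<open>m + 1\<close>, this is the inner product of their projections to the equatorial
  hyperplane.\<close>

definition ip :: "nat \<Rightarrow> (nat \<Rightarrow> real) \<Rightarrow> (nat \<Rightarrow> real) \<Rightarrow> real"
  where "ip m x y = (\<Sum>i\<le>m. x i * y i)"

lemma ip_commute: "ip m x y = ip m y x"
  by (simp add: ip_def mult.commute)

lemma ip_minus_left: "ip m (\<lambda>i. - x i) y = - ip m x y"
  by (simp add: ip_def sum_negf)

lemma ip_minus_right: "ip m x (\<lambda>i. - y i) = - ip m x y"
  by (simp add: ip_def sum_negf)

lemma ip_Suc: "ip (Suc m) x y = ip m x y + x (Suc m) * y (Suc m)"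
  by (simp add: ip_def)

lemma ip_Cauchy_Schwarz: "(ip m x y)\<^sup>2 \<le> ip m x x * ip m y y"
  using Cauchy_Schwarz_ineq_sum[of x y "{..m}"] by (simp add: ip_def power2_eq_square)

lemma ip_combination:
  "ip m (\<lambda>i. x i - s * y i) (\<lambda>i. z i - t * y i)
     = ip m x z - t * ip m x y - s * ip m y z + s * t * ip m y y"
  by (simp add: ip_def algebra_simps sum.distrib sum_subtractf sum_distrib_left)

lemma sphere_dist_ip: "sphere_dist m x y = arccos (ip m x y)"
  by (simp add: sphere_dist_def ip_def)

lemma unit_sphere_ip: "x \<in> unit_sphere m \<longleftrightarrow> ip m x x = 1 \<and> (\<forall>i>m. x i = 0)"
  by (simp add: unit_sphere_iff ip_def power2_eq_square)

lemma unit_sphere_minus: "(\<lambda>i. - x i) \<in> unit_sphere m \<longleftrightarrow> x \<in> unit_sphere m"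
  by (simp add: unit_sphere_ip ip_minus_left ip_minus_right)

lemma unit_sphere_equator: "x \<in> unit_sphere m \<Longrightarrow> x \<in> unit_sphere (Suc m)"
  by (simp add: unit_sphere_ip ip_Suc)

lemma ip_unit_bounds:
  assumes "ip m x x = 1" "ip m y y = 1"
  shows "-1 \<le> ip m x y" "ip m x y \<le> 1"
  using ip_Cauchy_Schwarz[of m x y] assms abs_square_le_1[of "ip m x y"] by auto

lemma sphere_dist_antipode:
  assumes "x \<in> unit_sphere m" "y \<in> unit_sphere m"
  shows "sphere_dist m x (\<lambda>i. - y i) = pi - sphere_dist m x y"
    and "sphere_dist m (\<lambda>i. - x i) y = pi - sphere_dist m x y"
proof -
  have "-1 \<le> ip m x y" "ip m x y \<le> 1"
    using ip_unit_bounds assms by (auto simp: unit_sphere_ip)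
  then show "sphere_dist m x (\<lambda>i. - y i) = pi - sphere_dist m x y"
    and "sphere_dist m (\<lambda>i. - x i) y = pi - sphere_dist m x y"
    by (simp_all add: sphere_dist_ip ip_minus_right ip_minus_left arccos_minus)
qed

text \<open>With \<open>\<alpha>\<close> and \<open>\<beta>\<close> the angles at \<open>y\<close>, Cauchy--Schwarz for the components of \<open>x\<close> and \<open>z\<close>
  orthogonal to \<open>y\<close>, which have lengths \<open>sin \<alpha>\<close> and \<open>sin \<beta>\<close>, gives
  \<open>\<langle>x, z\<rangle> \<ge> cos \<alpha> cos \<beta> - sin \<alpha> sin \<beta> = cos (\<alpha> + \<beta>)\<close>.\<close>

lemma sphere_dist_triangle:
  assumes "x \<in> unit_sphere m" "y \<in> unit_sphere m" "z \<in> unit_sphere m"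
  shows "sphere_dist m x z \<le> sphere_dist m x y + sphere_dist m y z"
proof -
  have unit: "ip m x x = 1" "ip m y y = 1" "ip m z z = 1"
    using assms by (auto simp: unit_sphere_ip)
  define a b c where "a = ip m x y" and "b = ip m y z" and "c = ip m x z"
  have bounds: "-1 \<le> a" "a \<le> 1" "-1 \<le> b" "b \<le> 1" "-1 \<le> c" "c \<le> 1"
    unfolding a_def b_def c_def using ip_unit_bounds unit by blast+
  show ?thesis
  proof (cases "arccos a + arccos b \<le> pi")
    case True
    have "(c - a * b)\<^sup>2 \<le> (1 - a\<^sup>2) * (1 - b\<^sup>2)"
      using ip_Cauchy_Schwarz[of m "\<lambda>i. x i - a * y i" "\<lambda>i. z i - b * y i"] unit
      unfolding ip_combination
      by (simp add: a_def b_def c_def ip_commute[of m y x] ip_commute[of m z y]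
          power2_eq_square algebra_simps)
    then have "\<bar>c - a * b\<bar> \<le> sqrt (1 - a\<^sup>2) * sqrt (1 - b\<^sup>2)"
      by (metis real_sqrt_abs real_sqrt_le_iff real_sqrt_mult)
    moreover have "cos (arccos a + arccos b) = a * b - sqrt (1 - a\<^sup>2) * sqrt (1 - b\<^sup>2)"
      using bounds by (simp add: cos_add sin_arccos)
    ultimately have "cos (arccos a + arccos b) \<le> c" by linarith
    then have "arccos c \<le> arccos (cos (arccos a + arccos b))"
      using bounds by (intro arccos_le_arccos) auto
    also have "\<dots> = arccos a + arccos b"
      using True bounds by (intro arccos_cos add_nonneg_nonneg arccos_lbound) auto
    finally show ?thesis by (simp add: sphere_dist_ip a_def b_def c_def)
  next
    case False
    then show ?thesis
      using arccos_ubound[of c] bounds by (simp add: sphere_dist_ip a_def b_def c_def)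
  qed
qed

lemma sphere_dist_sym: "sphere_dist m x y = sphere_dist m y x"
  by (simp add: sphere_dist_ip ip_commute)

section \<open>A quadratic inequality on the positive orthant\<close>

text \<open>For \<open>\<kappa> = 1 / (card K + 1)\<close> this is the inner product of the mean-free parts of two vectors
  that are indexed by \<open>K\<close> and one further index at which both vanish.\<close>

definition centered_ip :: "real \<Rightarrow> 'k set \<Rightarrow> ('k \<Rightarrow> real) \<Rightarrow> ('k \<Rightarrow> real) \<Rightarrow> real"
  where "centered_ip \<kappa> K a b = (\<Sum>k\<in>K. a k * b k) - \<kappa> * ((\<Sum>k\<in>K. a k) * (\<Sum>k\<in>K. b k))"

text \<open>Nonnegativity of this form says that \<open>a\<close> and \<open>b\<close>, when they have equal length for
  \<^const>\<open>centered_ip\<close>, enclose an angle of cosine at least \<open>- c\<close>.\<close>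

definition gap_form :: "real \<Rightarrow> real \<Rightarrow> 'k set \<Rightarrow> ('k \<Rightarrow> real) \<Rightarrow> ('k \<Rightarrow> real) \<Rightarrow> real"
  where "gap_form c \<kappa> K a b = c / 2 * (centered_ip \<kappa> K a a + centered_ip \<kappa> K b b) + centered_ip \<kappa> K a b"

lemma centered_ip_self_lower_bound:
  assumes "finite K" "P \<subseteq> K" "\<And>k. k \<in> K - P \<Longrightarrow> a k = 0"
  shows "(1 - \<kappa> * real (card P)) * (sum a K)\<^sup>2 \<le> real (card P) * centered_ip \<kappa> K a a"
proof -
  have *: "sum f P = sum f K" if "\<And>k. k \<in> K - P \<Longrightarrow> f k = 0" for f :: "_ \<Rightarrow> real"
    using assms that by (intro sum.mono_neutral_left) auto
  have "(sum a P)\<^sup>2 \<le> (\<Sum>k\<in>P. (a k)\<^sup>2) * card P"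
    using Cauchy_Schwarz_ineq_sum[of a "\<lambda>_. 1" P] by simp
  then have "(sum a K)\<^sup>2 \<le> (\<Sum>k\<in>K. (a k)\<^sup>2) * card P"
    using assms(3) *[of a] *[of "\<lambda>k. (a k)\<^sup>2"] by simp
  then show ?thesis
    by (simp add: centered_ip_def power2_eq_square algebra_simps)
qed

lemma centered_ip_self_nonneg:
  assumes "finite K" "\<kappa> * real (card K) \<le> 1"
  shows "0 \<le> centered_ip \<kappa> K a a"
proof (cases "K = {}")
  case True
  then show ?thesis by (simp add: centered_ip_def)
next
  case False
  then have "0 < card K" using assms by (simp add: card_gt_0_iff)
  moreover have "0 \<le> real (card K) * centered_ip \<kappa> K a a"
  proof (rule order_trans)
    show "0 \<le> (1 - \<kappa> * real (card K)) * (sum a K)\<^sup>2" using assms by simp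
  qed (use assms in \<open>auto intro: centered_ip_self_lower_bound\<close>)
  ultimately show ?thesis by (simp add: zero_le_mult_iff)
qed

text \<open>The form is concave along the move that trades \<open>a j\<close> against \<open>b j\<close> while keeping their sum:
  on \<open>[0, a j + b j]\<close> it lies above the chord through the two end points, where one of the
  entries is zero.\<close>

lemma gap_form_exchange:
  fixes a b :: "'k \<Rightarrow> real"
  assumes "finite K" "j \<in> K"
  defines "s \<equiv> a j + b j"
  shows "s * gap_form c \<kappa> K a b = b j * gap_form c \<kappa> K (a(j := 0)) (b(j := s))
      + a j * gap_form c \<kappa> K (a(j := s)) (b(j := 0)) + (1 - c) * (1 - \<kappa>) * s * a j * b j"
proof -
  define L where "L = K - {j}"
  have split: "sum f K = f j + sum f L" for f :: "_ \<Rightarrow> real"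
    unfolding L_def using assms by (intro sum.remove) auto
  have upd: "(\<Sum>k\<in>L. (f(j := u)) k * (g(j := v)) k) = (\<Sum>k\<in>L. f k * g k)"
       "(\<Sum>k\<in>L. (f(j := u)) k) = sum f L" for f g :: "_ \<Rightarrow> real" and u v
    unfolding L_def by (auto intro!: sum.cong)
  show ?thesis
    unfolding gap_form_def centered_ip_def split upd s_def
    by (simp add: field_simps)
qed

text \<open>The coordinates in which both vectors are positive are removed one at a time; each exchange
  leads to two pairs with one such coordinate less.\<close>

lemma gap_form_nonneg_by_disjoint_supports:
  assumes "finite K" "c \<le> 1" "\<kappa> \<le> 1"
    and disjoint: "\<And>a b. (\<And>k. k \<in> K \<Longrightarrow> 0 \<le> a k \<and> 0 \<le> b k \<and> a k * b k = 0)
                     \<Longrightarrow> 0 \<le> gap_form c \<kappa> K a b"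
    and "\<And>k. k \<in> K \<Longrightarrow> 0 \<le> a k \<and> 0 \<le> b k"
  shows "0 \<le> gap_form c \<kappa> K a b"
proof -
  have "0 \<le> gap_form c \<kappa> K a b"
    if "finite F" "F \<subseteq> K" "\<And>k. k \<in> K \<Longrightarrow> 0 \<le> a k \<and> 0 \<le> b k" "\<And>k. k \<in> K - F \<Longrightarrow> a k * b k = 0"
    for F a b
    using that
  proof (induction F arbitrary: a b rule: finite_induct)
    case empty
    then show ?case by (intro disjoint) auto
  next
    case (insert j F)
    define s where "s = a j + b j"
    have j: "j \<in> K" "0 \<le> a j" "0 \<le> b j" using insert.prems by auto
    show ?case
    proof (cases "s = 0")
      case True
      then have "a j = 0" using j by (simp add: s_def)
      then show ?thesis
        using insert.prems by (intro insert.IH) fastforce+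
    next
      case False
      then have "0 < s" using j by (simp add: s_def)
      have "0 \<le> gap_form c \<kappa> K (a(j := 0)) (b(j := s))"
           "0 \<le> gap_form c \<kappa> K (a(j := s)) (b(j := 0))"
        using insert.prems \<open>0 < s\<close> by (auto intro!: insert.IH)
      then have "0 \<le> s * gap_form c \<kappa> K a b"
        unfolding s_def gap_form_exchange[OF \<open>finite K\<close> j(1)] using j assms(2,3) by simp
      then show ?thesis using \<open>0 < s\<close> by (simp add: zero_le_mult_iff)
    qed
  qed
  from this[of K] show ?thesis using assms by auto
qed

text \<open>With supports of sizes \<open>p\<close> and \<open>q\<close> and coordinate sums \<open>A\<close> and \<open>B\<close>, Cauchy--Schwarz bounds the
  squared lengths from below by \<open>\<kappa> * A\<^sup>2 * (q + 1) / p\<close> and \<open>\<kappa> * B\<^sup>2 * (p + 1) / q\<close>, while the mixed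
  term is \<open>- \<kappa> * A * B\<close>. The inequality between arithmetic and geometric mean then leaves
  exactly the hypothesis on \<open>c\<close>.\<close>

lemma gap_form_nonneg_disjoint:
  assumes "finite K" "0 \<le> c" and \<kappa>: "\<kappa> = 1 / (real (card K) + 1)"
    and c: "\<And>p q. p + q = card K \<Longrightarrow> real p * real q \<le> c\<^sup>2 * ((real p + 1) * (real q + 1))"
    and ab: "\<And>k. k \<in> K \<Longrightarrow> 0 \<le> a k \<and> 0 \<le> b k \<and> a k * b k = 0"
  shows "0 \<le> gap_form c \<kappa> K a b"
proof -
  \<comment> \<open>Indices at which both vectors vanish are counted in \<open>Q\<close>, so that the sizes add up to
    \<open>card K\<close>.\<close>
  define P Q where "P = {k \<in> K. a k \<noteq> 0}" and "Q = K - P"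
  define p q where "p = real (card P)" and "q = real (card Q)"
  define A B where "A = sum a K" and "B = sum b K"
  define X Y where "X = centered_ip \<kappa> K a a" and "Y = centered_ip \<kappa> K b b"
  have "P \<subseteq> K" "Q \<subseteq> K" by (auto simp: P_def Q_def)
  have fin: "finite P" "finite Q" using \<open>finite K\<close> by (auto simp: P_def Q_def)
  have "card K = card P + card Q"
    using \<open>finite K\<close> card_Diff_subset[OF fin(1)] card_mono[of K P] by (auto simp: P_def Q_def)
  then have pq: "p * q \<le> c\<^sup>2 * ((p + 1) * (q + 1))" and \<kappa>: "\<kappa> = 1 / (p + q + 1)"
    using c[of "card P" "card Q"] \<kappa> by (auto simp: p_def q_def)
  have a0: "a k = 0" if "k \<in> K - P" for k using that by (auto simp: P_def)
  have b0: "b k = 0" if "k \<in> K - Q" for k using that ab by (auto simp: P_def Q_def)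
  have "(\<Sum>k\<in>K. a k * b k) = 0" using ab by (intro sum.neutral) auto
  then have ab_form: "centered_ip \<kappa> K a b = - \<kappa> * (A * B)" by (simp add: centered_ip_def A_def B_def)
  have "0 \<le> p" "0 \<le> q" by (auto simp: p_def q_def)
  have "\<kappa> * real (card K) \<le> 1"
    using \<open>card K = _\<close> \<open>0 \<le> p\<close> \<open>0 \<le> q\<close> by (simp add: \<kappa> p_def q_def)
  then have X: "0 \<le> X" and Y: "0 \<le> Y"
    unfolding X_def Y_def using \<open>finite K\<close> by (auto intro: centered_ip_self_nonneg)
  have "0 < \<kappa>" and factors: "1 - \<kappa> * p = \<kappa> * (q + 1)" "1 - \<kappa> * q = \<kappa> * (p + 1)"
    using \<open>0 \<le> p\<close> \<open>0 \<le> q\<close> by (auto simp: \<kappa> field_simps)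
  have "(1 - \<kappa> * p) * A\<^sup>2 \<le> p * X"
    unfolding X_def A_def p_def using \<open>finite K\<close> \<open>P \<subseteq> K\<close> a0 by (rule centered_ip_self_lower_bound)
  moreover have "(1 - \<kappa> * q) * B\<^sup>2 \<le> q * Y"
    unfolding Y_def B_def q_def using \<open>finite K\<close> \<open>Q \<subseteq> K\<close> b0 by (rule centered_ip_self_lower_bound)
  ultimately have "\<kappa> * (q + 1) * A\<^sup>2 \<le> p * X" "\<kappa> * (p + 1) * B\<^sup>2 \<le> q * Y"
    unfolding factors by auto
  \<comment> \<open>Multiplying out instead of dividing by \<open>p * q\<close> covers empty supports as well.\<close>
  then have "(\<kappa> * (q + 1) * A\<^sup>2) * (\<kappa> * (p + 1) * B\<^sup>2) \<le> (p * X) * (q * Y)"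
    by (rule mult_mono) (use \<open>0 < \<kappa>\<close> \<open>0 \<le> p\<close> \<open>0 \<le> q\<close> X in auto)
  also have "\<dots> \<le> c\<^sup>2 * ((p + 1) * (q + 1)) * (X * Y)"
    using mult_right_mono[OF pq, of "X * Y"] X Y by (simp add: mult_ac)
  finally have "((p + 1) * (q + 1)) * (\<kappa> * (A * B))\<^sup>2 \<le> ((p + 1) * (q + 1)) * (c\<^sup>2 * (X * Y))"
    by (simp add: power2_eq_square mult_ac)
  then have "(\<kappa> * (A * B))\<^sup>2 \<le> c\<^sup>2 * (X * Y)"
    using \<open>0 \<le> p\<close> \<open>0 \<le> q\<close> by (subst (asm) mult_le_cancel_left_pos) auto
  also have "\<dots> \<le> (c / 2 * (X + Y))\<^sup>2"
    using mult_left_mono[OF zero_le_power2[of "X - Y"], of "c\<^sup>2 / 4"]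
    by (simp add: power2_eq_square algebra_simps)
  finally have "\<kappa> * (A * B) \<le> c / 2 * (X + Y)"
    by (rule power2_le_imp_le) (use X Y \<open>0 \<le> c\<close> in auto)
  then show ?thesis by (simp add: gap_form_def ab_form X_def Y_def)
qed

lemma centered_ip_lower_bound:
  assumes "finite K" "0 \<le> c" "c \<le> 1" and \<kappa>: "\<kappa> = 1 / (real (card K) + 1)"
    and "\<And>p q. p + q = card K \<Longrightarrow> real p * real q \<le> c\<^sup>2 * ((real p + 1) * (real q + 1))"
    and "\<And>k. k \<in> K \<Longrightarrow> 0 \<le> a k \<and> 0 \<le> b k"
    and "centered_ip \<kappa> K a a \<le> r" "centered_ip \<kappa> K b b \<le> r"
  shows "- c * r \<le> centered_ip \<kappa> K a b"
proof -
  have "0 \<le> gap_form c \<kappa> K a b"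
    using assms(1,3)
  proof (rule gap_form_nonneg_by_disjoint_supports)
    show "\<kappa> \<le> 1" by (simp add: \<kappa>)
  qed (use assms(6) in \<open>auto intro: gap_form_nonneg_disjoint[OF assms(1,2) \<kappa> assms(5)]\<close>)
  moreover have "c / 2 * (centered_ip \<kappa> K a a + centered_ip \<kappa> K b b) \<le> c / 2 * (r + r)"
    using assms(2,7,8) by (intro mult_left_mono add_mono) auto
  ultimately show ?thesis by (simp add: gap_form_def)
qed

section \<open>The regular simplex and its Voronoi cells\<close>

text \<open>The regular simplex with \<open>m + 2\<close> vertices in dimension \<open>m + 1\<close>: the standard basis,
  scaled and shifted along the diagonal, together with the unit vector opposite to the diagonal.
  The scale \<open>\<alpha>\<close> and the shift are those for which the vertices are unit vectors with sum zero.\<close>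

definition vertex :: "nat \<Rightarrow> nat \<Rightarrow> nat \<Rightarrow> real" where
  "vertex m k i = (let \<rho> = 1 / sqrt (real m + 1); \<alpha> = sqrt ((real m + 2) / (real m + 1)) in
     if m < i then 0
     else if k \<le> m then (if i = k then \<alpha> else 0) + (\<rho> - \<alpha>) / (real m + 1)
     else - \<rho>)"

text \<open>The frame identity: up to the factor \<open>(m + 2) / (m + 1)\<close>, the inner products with the
  vertices embed the Euclidean space isometrically onto the vectors with coordinate sum zero.\<close>

lemma
  shows sum_ip_vertex: "(\<Sum>k\<le>Suc m. ip m x (vertex m k)) = 0"
    and vertex_frame: "(\<Sum>k\<le>Suc m. ip m x (vertex m k) * ip m y (vertex m k))
      = (real m + 2) / (real m + 1) * ip m x y"
    and ip_vertex: "k \<le> Suc m \<Longrightarrow> l \<le> Suc m \<Longrightarrow>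
      ip m (vertex m k) (vertex m l) = (if k = l then 1 else - 1 / (real m + 1))"
proof -
  define n where "n = real m + 1"
  define \<rho> \<alpha> where "\<rho> = 1 / sqrt (real m + 1)"
    and "\<alpha> = sqrt ((real m + 2) / (real m + 1))"
  define \<beta> where "\<beta> = (\<rho> - \<alpha>) / n"
  have n: "n > 0" by (simp add: n_def)
  have \<rho>2: "n * \<rho>\<^sup>2 = 1" and \<alpha>2: "n * \<alpha>\<^sup>2 = n + 1" and \<beta>: "n * \<beta> = \<rho> - \<alpha>"
    using n by (auto simp: \<rho>_def \<alpha>_def \<beta>_def n_def power_divide)
  have \<rho>2': "n * (\<rho> * \<rho>) = 1" and \<alpha>2': "n * (\<alpha> * \<alpha>) = n + 1"
    using \<rho>2 \<alpha>2 by (auto simp: power2_eq_square)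
  have vertex: "vertex m k i = (if i = k then \<alpha> else 0) + \<beta>" if "k \<le> m" "i \<le> m" for k i
    using that by (simp add: vertex_def Let_def \<rho>_def \<alpha>_def \<beta>_def n_def)
  have vertex': "vertex m (Suc m) i = - \<rho>" if "i \<le> m" for i
    using that by (simp add: vertex_def Let_def \<rho>_def)
  define S where "S = (\<lambda>x. \<Sum>i\<le>m. x i :: real)"
  have ipk: "ip m x (vertex m k) = \<alpha> * x k + \<beta> * S x" if "k \<le> m" for x k
  proof -
    have "ip m x (vertex m k) = (\<Sum>i\<le>m. (if i = k then \<alpha> * x i else 0) + \<beta> * x i)"
      unfolding ip_def using that by (intro sum.cong) (auto simp: vertex algebra_simps)
    also have "\<dots> = \<alpha> * x k + \<beta> * S x"
      using that by (simp add: sum.distrib sum_distrib_left S_def)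
    finally show ?thesis .
  qed
  have ipn: "ip m x (vertex m (Suc m)) = - \<rho> * S x" for x
    by (simp add: ip_def vertex' S_def sum_distrib_left sum_distrib_right mult.commute sum_negf)
  have card: "(\<Sum>i\<le>m. r) = n * r" for r :: real
    by (simp add: n_def algebra_simps)
  have "(\<Sum>k\<le>Suc m. ip m x (vertex m k)) = \<alpha> * S x + (n * \<beta>) * S x - \<rho> * S x"
    by (simp add: ipk ipn sum.distrib card S_def flip: sum_distrib_left) (simp add: n_def)
  then show "(\<Sum>k\<le>Suc m. ip m x (vertex m k)) = 0"
    unfolding \<beta> by (simp add: algebra_simps)
  have "n * (\<rho>\<^sup>2 - \<alpha>\<^sup>2 + 1) = 0"
    using \<rho>2 \<alpha>2 by (simp add: algebra_simps)
  then have diff: "\<rho>\<^sup>2 - \<alpha>\<^sup>2 = - 1" using n by simp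
  have "n * (2 * \<alpha> * \<beta> + n * \<beta>\<^sup>2 + \<rho>\<^sup>2) = 2 * \<alpha> * (n * \<beta>) + (n * \<beta>)\<^sup>2 + n * \<rho>\<^sup>2"
    by (simp add: power2_eq_square algebra_simps)
  also have "\<dots> = \<rho>\<^sup>2 - \<alpha>\<^sup>2 + 1"
    unfolding \<beta> \<rho>2 by (simp add: power2_eq_square algebra_simps)
  finally have frame_const: "2 * \<alpha> * \<beta> + n * \<beta>\<^sup>2 + \<rho>\<^sup>2 = 0"
    using diff n by simp
  show "(\<Sum>k\<le>Suc m. ip m x (vertex m k) * ip m y (vertex m k))
      = (real m + 2) / (real m + 1) * ip m x y"
  proof -
    have "(\<Sum>k\<le>Suc m. ip m x (vertex m k) * ip m y (vertex m k))
      = (\<Sum>k\<le>m. \<alpha>\<^sup>2 * (x k * y k) + \<alpha> * \<beta> * S y * x k + \<alpha> * \<beta> * S x * y k + \<beta>\<^sup>2 * S x * S y)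
        + \<rho>\<^sup>2 * S x * S y"
      by (simp add: ipk ipn power2_eq_square algebra_simps)
    also have "\<dots> = \<alpha>\<^sup>2 * ip m x y + (2 * \<alpha> * \<beta> + n * \<beta>\<^sup>2 + \<rho>\<^sup>2) * (S x * S y)"
      by (simp add: sum.distrib card ip_def S_def flip: sum_distrib_left)
        (simp add: power2_eq_square n_def algebra_simps)
    also have "\<dots> = (n + 1) / n * ip m x y"
    proof -
      have "\<alpha>\<^sup>2 = (n + 1) / n" using \<alpha>2 n by (simp add: field_simps)
      then show ?thesis unfolding frame_const by simp
    qed
    finally show ?thesis by (simp add: n_def add.commute)
  qed
  show "ip m (vertex m k) (vertex m l) = (if k = l then 1 else - 1 / (real m + 1))"
    if "k \<le> Suc m" "l \<le> Suc m"
  proof -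
    have S: "S (vertex m k) = \<rho>" if "k \<le> m" for k
    proof -
      have "S (vertex m k) = \<alpha> + n * \<beta>"
        using that unfolding S_def by (simp add: vertex sum.distrib n_def)
      then show ?thesis by (simp add: \<beta>)
    qed
    have S': "S (vertex m (Suc m)) = - n * \<rho>"
      unfolding S_def by (simp add: vertex' n_def algebra_simps)
    have \<beta>\<rho>: "\<beta> * (\<alpha> + \<rho>) = - 1 / n"
    proof -
      have "\<beta> * (\<alpha> + \<rho>) = (\<rho>\<^sup>2 - \<alpha>\<^sup>2) / n"
        using n by (simp add: \<beta>_def power2_eq_square field_simps)
      then show ?thesis by (simp add: diff)
    qed
    have \<alpha>\<alpha>: "\<alpha> * \<alpha> = 1 + 1 / n"
      using \<alpha>2' n by (simp add: field_simps)
    have \<rho>\<rho>: "\<rho> * \<rho> = 1 / n"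
      using \<rho>2' n by (simp add: field_simps)
    consider "k \<le> m" "l \<le> m" | "k = Suc m" "l \<le> m" | "k \<le> m" "l = Suc m"
      | "k = Suc m" "l = Suc m"
      using \<open>k \<le> Suc m\<close> \<open>l \<le> Suc m\<close> by linarith
    then show ?thesis
    proof cases
      case 1
      then have "ip m (vertex m k) (vertex m l) = (if k = l then \<alpha> * \<alpha> else 0) + \<beta> * (\<alpha> + \<rho>)"
        by (simp add: ipk vertex S algebra_simps)
      then show ?thesis by (simp add: \<beta>\<rho> \<alpha>\<alpha> n_def)
    next
      case 2
      then have "ip m (vertex m k) (vertex m l) = - (\<rho> * \<rho>)"
        unfolding ip_commute[of m "vertex m k"] by (simp add: ipn S)
      then show ?thesis using 2 by (simp add: \<rho>\<rho> n_def)
    next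
      case 3
      then have "ip m (vertex m k) (vertex m l) = - (\<rho> * \<rho>)"
        by (simp add: ipn S)
      then show ?thesis using 3 by (simp add: \<rho>\<rho> n_def)
    next
      case 4
      then have "ip m (vertex m k) (vertex m l) = n * (\<rho> * \<rho>)"
        by (simp add: ipn S')
      then show ?thesis using 4 \<rho>2' by simp
    qed
  qed
qed

section \<open>The diameter of a Voronoi cell\<close>

definition neg_cos_eta :: "nat \<Rightarrow> real" where
  "neg_cos_eta m = (if odd m then (real m + 1) / (real m + 3) else sqrt (real m / (real m + 4)))"

lemma eta_arccos: "eta m = arccos (- neg_cos_eta m)"
  by (simp add: eta_def neg_cos_eta_def)

lemma neg_cos_eta_bounds: "0 \<le> neg_cos_eta m" "neg_cos_eta m \<le> 1"
  by (auto simp: neg_cos_eta_def)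

text \<open>As \<open>(p + 1) * (q + 1) = p * q + m + 2\<close>, the quotient \<open>p * q / ((p + 1) * (q + 1))\<close> increases
  with \<open>p * q\<close>, and \<open>4 * p * q = (m + 1)\<^sup>2 - (p - q)\<^sup>2\<close>. For even \<open>m\<close> the difference \<open>p - q\<close> is odd,
  which lowers the maximum of \<open>4 * p * q\<close> from \<open>(m + 1)\<^sup>2\<close> to \<open>m * (m + 2)\<close>.\<close>

lemma neg_cos_eta_split_bound:
  assumes "p + q = Suc m"
  shows "real p * real q \<le> (neg_cos_eta m)\<^sup>2 * ((real p + 1) * (real q + 1))"
proof -
  define d where "d = real p - real q"
  have m: "real m + 1 = real p + real q" using assms by linarith
  have 4: "4 * (real p * real q) = (real m + 1)\<^sup>2 - d\<^sup>2"
    unfolding m d_def by (simp add: power2_eq_square algebra_simps)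
  have pq: "(real p + 1) * (real q + 1) = real p * real q + real m + 2"
    using m by (simp add: algebra_simps)
  show ?thesis
  proof (cases "odd m")
    case True
    have "4 * (real p * real q) * (real m + 2) \<le> (real m + 1)\<^sup>2 * (real m + 2)"
      unfolding 4 by (intro mult_right_mono) auto
    then have "real p * real q * (real m + 3)\<^sup>2 \<le> (real m + 1)\<^sup>2 * (real p * real q + real m + 2)"
      by (simp add: power2_eq_square algebra_simps)
    then show ?thesis
      using True unfolding pq by (simp add: neg_cos_eta_def power_divide field_simps)
  next
    case False
    have "p \<noteq> q" using assms False by presburger
    then have "1 \<le> \<bar>d\<bar>" unfolding d_def by linarith
    then have "1 \<le> d\<^sup>2" using abs_le_square_iff[of 1 d] by simp
    then have "4 * (real p * real q) \<le> real m * (real m + 2)"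
      unfolding 4 by (simp add: power2_eq_square algebra_simps)
    then have "real p * real q * (real m + 4) \<le> real m * (real p * real q + real m + 2)"
      by (simp add: algebra_simps)
    then show ?thesis
      using False unfolding pq by (simp add: neg_cos_eta_def field_simps)
  qed
qed

text \<open>Two vertices of the simplex are no farther apart than \<open>eta m\<close>.\<close>

lemma neg_cos_eta_ge_vertex:
  assumes "m \<ge> 1"
  shows "1 / (real m + 1) \<le> neg_cos_eta m"
proof (rule power2_le_imp_le)
  \<comment> \<open>Already the most uneven split of \<open>m + 1\<close> into positive parts, which gives the weakest bound
    on \<open>neg_cos_eta m\<close>, suffices.\<close>
  have 1: "real m \<le> (neg_cos_eta m)\<^sup>2 * (2 * (real m + 1))"
    using neg_cos_eta_split_bound[of 1 m m] by simp
  have "1 \<le> real m" using assms by simp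
  then have "2 \<le> real m * (real m + 1)"
    using mult_mono[of 1 "real m" 2 "real m + 1"] by simp
  also have "\<dots> \<le> (neg_cos_eta m)\<^sup>2 * (2 * (real m + 1)) * (real m + 1)"
    using 1 by (rule mult_right_mono) simp
  also have "\<dots> = 2 * ((neg_cos_eta m)\<^sup>2 * (real m + 1)\<^sup>2)"
    by (simp add: power2_eq_square algebra_simps)
  finally have "1 \<le> (neg_cos_eta m)\<^sup>2 * (real m + 1)\<^sup>2"
    by simp
  then show "(1 / (real m + 1))\<^sup>2 \<le> (neg_cos_eta m)\<^sup>2"
    by (simp add: power_divide field_simps)
qed (rule neg_cos_eta_bounds)

text \<open>The set is a linear cone that is unbounded in all coordinates beyond \<open>m\<close>. Hence its trace on
  the sphere of dimension \<open>m\<close> is a Voronoi cell, and its trace on the closed upper hemisphere of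
  dimension \<open>m + 1\<close> is the geodesic cone over that cell.\<close>

definition vertex_cell :: "nat \<Rightarrow> nat \<Rightarrow> (nat \<Rightarrow> real) set"
  where "vertex_cell m i = {x. \<forall>k\<le>Suc m. ip m x (vertex m k) \<le> ip m x (vertex m i)}"

lemma vertex_in_cell: "i \<le> Suc m \<Longrightarrow> vertex m i \<in> vertex_cell m i"
proof -
  have "- 1 / (real m + 1) \<le> 1" by (rule order_trans[of _ 0]) auto
  then show "i \<le> Suc m \<Longrightarrow> vertex m i \<in> vertex_cell m i"
    by (auto simp: vertex_cell_def ip_vertex)
qed

lemma in_some_cell: obtains i where "i \<le> Suc m" "x \<in> vertex_cell m i"
proof -
  let ?f = "\<lambda>k. ip m x (vertex m k)"
  have "Max (?f ` {..Suc m}) \<in> ?f ` {..Suc m}" by (rule Max_in) auto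
  then obtain i where "i \<le> Suc m" "Max (?f ` {..Suc m}) = ?f i" by blast
  moreover have "?f k \<le> Max (?f ` {..Suc m})" if "k \<le> Suc m" for k
    using that by (intro Max_ge) auto
  ultimately show ?thesis using that by (simp add: vertex_cell_def)
qed

text \<open>A common shift of the coordinates \<open>\<langle>x, u\<^sub>k\<rangle>\<close> does not affect their mean-free part, and these
  coordinates have sum zero; so the frame identity survives the passage to the coordinates
  \<open>\<langle>x, u\<^sub>i\<rangle> - \<langle>x, u\<^sub>k\<rangle>\<close>, which are nonnegative exactly on the cell of \<open>u\<^sub>i\<close>.\<close>

lemma ip_cell_centered_ip:
  assumes "i \<le> Suc m"
  shows "centered_ip (1 / (real m + 2)) ({..Suc m} - {i})
      (\<lambda>k. ip m x (vertex m i) - ip m x (vertex m k))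
      (\<lambda>k. ip m y (vertex m i) - ip m y (vertex m k))
    = (real m + 2) / (real m + 1) * ip m x y"
proof -
  define f g where "f = (\<lambda>k. ip m x (vertex m k))" and "g = (\<lambda>k. ip m y (vertex m k))"
  have sums: "sum f {..Suc m} = 0" "sum g {..Suc m} = 0"
    unfolding f_def g_def by (rule sum_ip_vertex)+
  have rem: "sum h ({..Suc m} - {i}) = sum h {..Suc m}" if "h i = 0" for h :: "nat \<Rightarrow> real"
    using that by (intro sum.mono_neutral_left) auto
  have const: "(\<Sum>k\<le>Suc m. r) = (real m + 2) * r" for r :: real
    by (simp add: algebra_simps)
  have F: "(\<Sum>k\<le>Suc m. f i - f k) = (real m + 2) * f i"
      and G: "(\<Sum>k\<le>Suc m. g i - g k) = (real m + 2) * g i"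
    by (simp_all only: sum_subtractf sums const)
  have "(\<Sum>k\<le>Suc m. (f i - f k) * (g i - g k))
      = (\<Sum>k\<le>Suc m. f i * g i) - f i * sum g {..Suc m} - g i * sum f {..Suc m}
        + (\<Sum>k\<le>Suc m. f k * g k)"
    unfolding sum_distrib_left by (simp only: flip: sum_subtractf sum.distrib)
      (auto intro!: sum.cong simp: algebra_simps)
  then have FG: "(\<Sum>k\<le>Suc m. (f i - f k) * (g i - g k))
      = (real m + 2) * (f i * g i) + (\<Sum>k\<le>Suc m. f k * g k)"
    unfolding sums const by simp
  have "centered_ip (1 / (real m + 2)) ({..Suc m} - {i}) (\<lambda>k. f i - f k) (\<lambda>k. g i - g k)
      = (\<Sum>k\<le>Suc m. f k * g k)"
    unfolding centered_ip_def by (subst (1 2 3) rem) (simp_all only: F G FG, simp_all add: field_simps)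
  also have "\<dots> = (real m + 2) / (real m + 1) * ip m x y"
    unfolding f_def g_def by (rule vertex_frame)
  finally show ?thesis by (simp add: f_def g_def)
qed

lemma ip_cell_lower_bound:
  assumes "i \<le> Suc m" "x \<in> vertex_cell m i" "y \<in> vertex_cell m i"
    and "ip m x x \<le> 1" "ip m y y \<le> 1"
  shows "- neg_cos_eta m \<le> ip m x y"
proof -
  define r where "r = (real m + 2) / (real m + 1)"
  have r: "r > 0" by (simp add: r_def)
  have card: "card ({..Suc m} - {i}) = Suc m" using assms by simp
  have "- neg_cos_eta m * r \<le> r * ip m x y"
    unfolding r_def ip_cell_centered_ip[OF assms(1), symmetric]
  proof (rule centered_ip_lower_bound)
    show "1 / (real m + 2) = 1 / (real (card ({..Suc m} - {i})) + 1)"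
      unfolding card by (simp add: add.commute)
  next
    show "real p * real q \<le> (neg_cos_eta m)\<^sup>2 * ((real p + 1) * (real q + 1))"
      if "p + q = card ({..Suc m} - {i})" for p q
      using that unfolding card by (rule neg_cos_eta_split_bound)
  next
    show "0 \<le> ip m x (vertex m i) - ip m x (vertex m k) \<and>
        0 \<le> ip m y (vertex m i) - ip m y (vertex m k)" if "k \<in> {..Suc m} - {i}" for k
      using that assms(2,3) by (auto simp: vertex_cell_def)
  next
    show "centered_ip (1 / (real m + 2)) ({..Suc m} - {i})
          (\<lambda>k. ip m x (vertex m i) - ip m x (vertex m k))
          (\<lambda>k. ip m x (vertex m i) - ip m x (vertex m k)) \<le> (real m + 2) / (real m + 1)"
        "centered_ip (1 / (real m + 2)) ({..Suc m} - {i})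
          (\<lambda>k. ip m y (vertex m i) - ip m y (vertex m k))
          (\<lambda>k. ip m y (vertex m i) - ip m y (vertex m k)) \<le> (real m + 2) / (real m + 1)"
      unfolding ip_cell_centered_ip[OF assms(1)] unfolding r_def[symmetric]
      using r assms(4,5) mult_left_le[of "ip m x x" r] mult_left_le[of "ip m y y" r] by simp_all
  qed (use neg_cos_eta_bounds[of m] in auto)
  then have "r * (- neg_cos_eta m) \<le> r * ip m x y"
    by (simp only: mult.commute[of r "- neg_cos_eta m"])
  then show ?thesis using r by (rule mult_left_le_imp_le)
qed

section \<open>The correspondence\<close>

text \<open>A point in several cells is related to several vertices, and a point of the equator also to
  itself; the distortion bound does not suffer, and no choices have to be made.\<close>

definition upper_relation :: "nat \<Rightarrow> ((nat \<Rightarrow> real) \<times> (nat \<Rightarrow> real)) set" where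
  "upper_relation m = {(x, x) | x. x \<in> unit_sphere m} \<union>
     {(vertex m i, p) | i p. i \<le> Suc m \<and> p \<in> unit_sphere (Suc m) \<and> 0 \<le> p (Suc m) \<and>
        p \<in> vertex_cell m i}"

lemma vertex_unit_sphere: "i \<le> Suc m \<Longrightarrow> vertex m i \<in> unit_sphere m"
  by (simp add: unit_sphere_ip ip_vertex) (simp add: vertex_def)

lemma upper_relation_spheres:
  assumes "(x, p) \<in> upper_relation m"
  shows "x \<in> unit_sphere m" "p \<in> unit_sphere (Suc m)"
  using assms by (auto simp: upper_relation_def vertex_unit_sphere unit_sphere_equator)

lemma sphere_dist_equator:
  assumes "x \<in> unit_sphere m"
  shows "sphere_dist (Suc m) x y = sphere_dist m x y"
  using assms by (simp add: sphere_dist_ip ip_Suc unit_sphere_ip)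

lemma sphere_dist_le_eta:
  assumes "x \<in> unit_sphere m" "y \<in> unit_sphere m" "- neg_cos_eta m' \<le> ip m x y"
  shows "sphere_dist m x y \<le> eta m'"
  using assms neg_cos_eta_bounds[of m'] ip_unit_bounds[of m x y]
  unfolding sphere_dist_ip eta_arccos unit_sphere_ip by (intro arccos_le_arccos) auto

text \<open>Raising two equatorial points towards the pole shrinks the equatorial part of their inner
  product and adds the nonnegative product of the heights, so it cannot fall below a nonpositive
  bound that was valid on the equator.\<close>

lemma sphere_dist_cone_le_eta:
  assumes "i \<le> Suc m" "p \<in> vertex_cell m i" "q \<in> vertex_cell m i"
    and "p \<in> unit_sphere (Suc m)" "q \<in> unit_sphere (Suc m)" "0 \<le> p (Suc m)" "0 \<le> q (Suc m)"
  shows "sphere_dist (Suc m) p q \<le> eta m"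
proof -
  have "ip m z z \<le> 1" if "z \<in> unit_sphere (Suc m)" for z
  proof -
    have "ip m z z + z (Suc m) * z (Suc m) = 1"
      using that by (simp add: unit_sphere_ip flip: ip_Suc)
    then show ?thesis using zero_le_square[of "z (Suc m)"] by linarith
  qed
  then have "- neg_cos_eta m \<le> ip m p q"
    using assms by (intro ip_cell_lower_bound) auto
  also have "\<dots> \<le> ip (Suc m) p q"
    using assms by (simp add: ip_Suc)
  finally show ?thesis
    using assms by (intro sphere_dist_le_eta) auto
qed

text \<open>The vertex \<open>u\<^sub>i\<close> and \<open>q\<close> lie in one cone, so that trading one for the other changes the
  distance from \<open>x\<close> by at most the diameter of that cone.\<close>

lemma equator_distortion:
  assumes "x \<in> unit_sphere m" "i \<le> Suc m" "q \<in> vertex_cell m i" "q \<in> unit_sphere (Suc m)"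
    "0 \<le> q (Suc m)"
  shows "\<bar>sphere_dist m x (vertex m i) - sphere_dist (Suc m) x q\<bar> \<le> eta m"
proof -
  let ?u = "vertex m i"
  have u: "?u \<in> unit_sphere (Suc m)" "?u (Suc m) = 0"
    using vertex_unit_sphere[OF assms(2)] unit_sphere_equator by (auto simp: vertex_def)
  have "sphere_dist (Suc m) ?u q \<le> eta m"
    using assms u vertex_in_cell by (intro sphere_dist_cone_le_eta) auto
  moreover have "sphere_dist (Suc m) x ?u \<le> sphere_dist (Suc m) x q + sphere_dist (Suc m) q ?u"
      "sphere_dist (Suc m) x q \<le> sphere_dist (Suc m) x ?u + sphere_dist (Suc m) ?u q"
    using assms u by (auto intro!: sphere_dist_triangle unit_sphere_equator)
  ultimately show ?thesis
    using assms(1) by (simp add: sphere_dist_equator sphere_dist_sym[of "Suc m" q])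
qed

text \<open>The distance \<open>\<zeta>\<close> of two vertices is at least \<open>pi / 2\<close>, hence no point of \<open>[0, pi]\<close> is farther
  from \<open>\<zeta>\<close> than \<open>0\<close> is.\<close>

lemma two_cells_distortion:
  assumes "m \<ge> 1" "i \<le> Suc m" "j \<le> Suc m" "i \<noteq> j"
    and "p \<in> unit_sphere (Suc m)" "q \<in> unit_sphere (Suc m)"
  shows "\<bar>sphere_dist m (vertex m i) (vertex m j) - sphere_dist (Suc m) p q\<bar> \<le> eta m"
proof -
  define z \<zeta> where "z = 1 / (real m + 1)" and "\<zeta> = arccos (- z)"
  have z: "0 \<le> z" "z \<le> 1" by (auto simp: z_def)
  have dist: "sphere_dist m (vertex m i) (vertex m j) = \<zeta>"
    using assms by (simp add: sphere_dist_ip ip_vertex z_def \<zeta>_def)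
  have "\<zeta> \<le> eta m"
    unfolding \<zeta>_def eta_arccos
    using z neg_cos_eta_ge_vertex[OF \<open>m \<ge> 1\<close>, folded z_def] neg_cos_eta_bounds[of m]
    by (intro arccos_le_arccos) auto
  moreover have "arccos z \<le> arccos (- z)"
    using z by (intro arccos_le_arccos) auto
  then have "pi - \<zeta> \<le> \<zeta>"
    unfolding \<zeta>_def using z arccos_minus[of z] by simp
  moreover have "0 \<le> sphere_dist (Suc m) p q" "sphere_dist (Suc m) p q \<le> pi"
    using assms ip_unit_bounds[of "Suc m" p q]
    by (auto simp: sphere_dist_ip unit_sphere_ip intro!: arccos_lbound arccos_ubound)
  ultimately show ?thesis
    unfolding dist by linarith
qed

lemma upper_relation_distortion:
  assumes "m \<ge> 1" "(x, p) \<in> upper_relation m" "(y, q) \<in> upper_relation m"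
  shows "\<bar>sphere_dist m x y - sphere_dist (Suc m) p q\<bar> \<le> eta m"
proof -
  consider (equator) "x = p" "y = q" "x \<in> unit_sphere m"
    | (left) j where "x = p" "x \<in> unit_sphere m" "y = vertex m j" "j \<le> Suc m"
        "q \<in> unit_sphere (Suc m)" "0 \<le> q (Suc m)" "q \<in> vertex_cell m j"
    | (right) i where "y = q" "y \<in> unit_sphere m" "x = vertex m i" "i \<le> Suc m"
        "p \<in> unit_sphere (Suc m)" "0 \<le> p (Suc m)" "p \<in> vertex_cell m i"
    | (cells) i j where "x = vertex m i" "i \<le> Suc m" "p \<in> unit_sphere (Suc m)" "0 \<le> p (Suc m)"
        "p \<in> vertex_cell m i" "y = vertex m j" "j \<le> Suc m" "q \<in> unit_sphere (Suc m)"
        "0 \<le> q (Suc m)" "q \<in> vertex_cell m j"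
    using assms(2,3) unfolding upper_relation_def by auto
  then show ?thesis
  proof cases
    case equator
    then show ?thesis by (simp add: sphere_dist_equator eta_nonneg)
  next
    case left
    then show ?thesis by (simp add: equator_distortion)
  next
    case right
    then show ?thesis
      using equator_distortion[of y m i p]
      by (simp add: sphere_dist_sym[of m "vertex m i"] sphere_dist_sym[of "Suc m" p])
  next
    case cells
    show ?thesis
    proof (cases "i = j")
      case True
      have "0 \<le> sphere_dist (Suc m) p q"
        using cells ip_unit_bounds[of "Suc m" p q]
        by (auto simp: sphere_dist_ip unit_sphere_ip intro!: arccos_lbound)
      moreover have "sphere_dist (Suc m) p q \<le> eta m"
        using cells True by (intro sphere_dist_cone_le_eta) auto
      ultimately show ?thesis
        using cells True by (simp add: sphere_dist_ip[of m] ip_vertex)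
    next
      case False
      then show ?thesis using cells assms(1) by (simp add: two_cells_distortion)
    qed
  qed
qed

definition antipodal_closure ::
    "((nat \<Rightarrow> real) \<times> (nat \<Rightarrow> real)) set \<Rightarrow> ((nat \<Rightarrow> real) \<times> (nat \<Rightarrow> real)) set" where
  "antipodal_closure R = R \<union> {(\<lambda>i. - x i, \<lambda>i. - p i) | x p. (x, p) \<in> R}"

text \<open>Passing to the antipodes in one of the two related pairs turns both distances \<open>d\<close> into
  \<open>pi - d\<close> and preserves the absolute value of their difference.\<close>

lemma antipodal_closure_distortion:
  assumes spheres: "\<And>x p. (x, p) \<in> R \<Longrightarrow> x \<in> unit_sphere m \<and> p \<in> unit_sphere n"
    and bound: "\<And>x p y q. (x, p) \<in> R \<Longrightarrow> (y, q) \<in> R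
      \<Longrightarrow> \<bar>sphere_dist m x y - sphere_dist n p q\<bar> \<le> e"
    and "(x, p) \<in> antipodal_closure R" "(y, q) \<in> antipodal_closure R"
  shows "\<bar>sphere_dist m x y - sphere_dist n p q\<bar> \<le> e"
proof -
  have flip: "\<bar>sphere_dist m x (\<lambda>i. - y i) - sphere_dist n p (\<lambda>i. - q i)\<bar>
        = \<bar>sphere_dist m x y - sphere_dist n p q\<bar>"
      "\<bar>sphere_dist m (\<lambda>i. - x i) y - sphere_dist n (\<lambda>i. - p i) q\<bar>
        = \<bar>sphere_dist m x y - sphere_dist n p q\<bar>"
    if "x \<in> unit_sphere m" "y \<in> unit_sphere m" "p \<in> unit_sphere n" "q \<in> unit_sphere n" for x y p q
    using that by (simp_all add: sphere_dist_antipode)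
  have right: "\<bar>sphere_dist m x y - sphere_dist n p q\<bar> \<le> e"
    if "(x, p) \<in> R" "(y, q) \<in> antipodal_closure R" for x p
    using that spheres bound by (auto simp: antipodal_closure_def flip)
  have "y \<in> unit_sphere m" "q \<in> unit_sphere n"
    using assms(4) spheres by (auto simp: antipodal_closure_def unit_sphere_minus)
  moreover have "(x, p) \<in> R \<or> (\<exists>x' p'. (x', p') \<in> R \<and> x = (\<lambda>i. - x' i) \<and> p = (\<lambda>i. - p' i))"
    using assms(3) by (auto simp: antipodal_closure_def)
  ultimately show ?thesis
    using right assms(4) spheres by (auto simp: flip)
qed

theorem proposition1p20:
  fixes m :: nat
  assumes "m \<ge> 1"
  shows "\<exists>R. correspondence (unit_sphere m) (unit_sphere (m + 1)) R \<and>
             distortion (sphere_dist m) (sphere_dist (m + 1)) R \<le> ennreal (eta m)"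
proof -
  let ?R = "antipodal_closure (upper_relation m)"
  have in_R: "x \<in> unit_sphere m \<and> p \<in> unit_sphere (Suc m)" if "(x, p) \<in> ?R" for x p
    using that upper_relation_spheres by (auto simp: antipodal_closure_def unit_sphere_minus)
  have "(x, x) \<in> ?R" if "x \<in> unit_sphere m" for x
    using that by (simp add: antipodal_closure_def upper_relation_def)
  then have "unit_sphere m \<subseteq> fst ` ?R" by force
  have "p \<in> snd ` ?R" if p: "p \<in> unit_sphere (Suc m)" for p
  proof -
    have upper: "\<exists>x. (x, q) \<in> upper_relation m"
      if "q \<in> unit_sphere (Suc m)" "0 \<le> q (Suc m)" for q
    proof -
      obtain i where "i \<le> Suc m" "q \<in> vertex_cell m i" by (rule in_some_cell)
      then have "(vertex m i, q) \<in> upper_relation m"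
        using that unfolding upper_relation_def by blast
      then show ?thesis by blast
    qed
    show ?thesis
    proof (cases "0 \<le> p (Suc m)")
      case True
      then show ?thesis using upper[OF p] by (force simp: antipodal_closure_def)
    next
      case False
      then obtain x where "(x, \<lambda>i. - p i) \<in> upper_relation m"
        using upper[of "\<lambda>i. - p i"] p by (auto simp: unit_sphere_minus)
      then have "(\<lambda>i. - x i, p) \<in> ?R"
        unfolding antipodal_closure_def by force
      then show ?thesis by force
    qed
  qed
  then have "unit_sphere (Suc m) \<subseteq> snd ` ?R" by blast
  moreover have sub: "?R \<subseteq> unit_sphere m \<times> unit_sphere (Suc m)"
    by (auto dest: in_R)
  have "fst ` ?R \<subseteq> unit_sphere m"
    by (rule order_trans[OF image_mono[OF sub]]) (simp add: fst_image_times)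
  moreover have "snd ` ?R \<subseteq> unit_sphere (Suc m)"
    by (rule order_trans[OF image_mono[OF sub]]) (simp add: snd_image_times)
  ultimately have "correspondence (unit_sphere m) (unit_sphere (Suc m)) ?R"
    unfolding correspondence_def using \<open>unit_sphere m \<subseteq> fst ` ?R\<close> sub
    by (intro conjI equalityI)
  moreover have "\<bar>sphere_dist m x y - sphere_dist (Suc m) p q\<bar> \<le> eta m"
    if "(x, p) \<in> ?R" "(y, q) \<in> ?R" for x p y q
    by (rule antipodal_closure_distortion[OF _ upper_relation_distortion[OF assms] that])
      (use upper_relation_spheres in blast)
  then have "distortion (sphere_dist m) (sphere_dist (Suc m)) ?R \<le> ennreal (eta m)"
    unfolding distortion_def by (auto intro!: SUP_least ennreal_leI)
  ultimately show ?thesis unfolding Suc_eq_plus1 by blast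
qed

end
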